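(* Let $S\subset\mathbb{R}^2$ be the Sierpinski Gasket. For two sequences $\mathbf a=a_1a_2a_3\ldots$ and $\mathbf b=b_1b_2b_3\ldots$ in $\{0,1,2\}$ with $a_i=b_i$ for $i=1,\ldots,k-1$ and $a_k\neq b_k$, put $$D(\mathbf a,\mathbf b)=\min\left\{\sum_{i=k+1}^{\infty}\frac{\alpha_i+\beta_i}{2^i}\,,\ \frac{1}{2^k}+\sum_{i=k+1}^{\infty}\frac{\gamma_i+\delta_i}{2^i}\right\},$$ where, for $i\ge k+1$, $\alpha_i=0$ if $a_i=b_k$ and $\alpha_i=1$ if $a_i\neq b_k$; $\beta_i=0$ if $b_i=a_k$ and $\beta_i=1$ if $b_i\neq a_k$; $\gamma_i=0$ if $a_i\neq a_k$ and $a_i\neq b_k$, and $\gamma_i=1$ otherwise; $\delta_i=0$ if $b_i\neq b_k$ and $b_i\neq a_k$, and $\delta_i=1$ otherwise; and put $D(\mathbf a,\mathbf a)=0$. Then the distance $d(a,b):=D(\mathbf a,\mathbf b)$ between points $a,b\in S$ with code representations $\mathbf a$, $\mathbf b$ does not depend on the choice of the code representations: if $\mathbf a,\mathbf a'$ are code representations of the same point $a\in S$ and $\mathbf b,\mathbf b'$ are code representations of the same point $b\in S$, then $D(\mathbf a,\mathbf b)=D(\mathbf a',\mathbf b')$.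
   Context: The Sierpinski Gasket $S\subset\mathbb{R}^2$ is the attractor (the unique nonempty compact set with $S=f_0(S)\cup f_1(S)\cup f_2(S)$) of the iterated function system $f_0(x,y)=(\tfrac12x,\tfrac12y)$, $f_1(x,y)=(\tfrac12x+\tfrac12,\tfrac12y)$, $f_2(x,y)=(\tfrac12x+\tfrac14,\tfrac12y+\tfrac{\sqrt3}{4})$. Code representations: for $a_1,\ldots,a_k\in\{0,1,2\}$ let $S_{a_1a_2\ldots a_k}=f_{a_1}\circ f_{a_2}\circ\cdots\circ f_{a_k}(S)$ (so $S_0,S_1,S_2$ are the left-bottom, right-bottom and upper parts of $S$, and similarly inside each sub-triangle). A sequence $a_1a_2a_3\ldots$ with $a_n\in\{0,1,2\}$ is a code representation of the point $a\in S$ if $\bigcap_{k=1}^\infty S_{a_1a_2\ldots a_k}=\{a\}$. Every point of $S$ has a code representation; it is unique except for junction points (intersection points of two of the three sub-triangles of some $S_{a_1\ldots a_k}$, or of $S$ itself), which have exactly two representations, of the form $a_1\ldots a_k\beta\alpha\alpha\alpha\ldots$ and $a_1\ldots a_k\alpha\beta\beta\beta\ldots$ with $\alpha\ne\beta$ in $\{0,1,2\}$. *)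

theory Defs
  imports "HOL-Analysis.Analysis"
begin

(* Only the indices 0, 1, 2 are meaningful; every index other than 0 and 1 is
   treated like 2, and all uses below restrict the index to {0,1,2}. *)
definition sg_map :: "nat \<Rightarrow> real \<times> real \<Rightarrow> real \<times> real" where
  "sg_map i = (\<lambda>(x, y).
     if i = 0 then (1/2 * x, 1/2 * y)
     else if i = 1 then (1/2 * x + 1/2, 1/2 * y)
     else (1/2 * x + 1/4, 1/2 * y + sqrt 3 / 4))"

definition sg_attractor :: "(real \<times> real) set \<Rightarrow> bool" where
  "sg_attractor S \<longleftrightarrow> S \<noteq> {} \<and> compact S \<and>
     S = sg_map 0 ` S \<union> sg_map 1 ` S \<union> sg_map 2 ` S"

definition sierpinski_gasket :: "(real \<times> real) set" where
  "sierpinski_gasket = (THE S. sg_attractor S)"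

(* foldr sg_map [a1, ..., ak] p = sg_map a1 (sg_map a2 (... (sg_map ak p))) *)
definition sg_cell :: "nat list \<Rightarrow> (real \<times> real) set" where
  "sg_cell w = foldr sg_map w ` sierpinski_gasket"

(* Sequences are indexed from 1; the value at index 0 is never used. *)
definition is_code :: "(nat \<Rightarrow> nat) \<Rightarrow> real \<times> real \<Rightarrow> bool" where
  "is_code a p \<longleftrightarrow> (\<forall>n\<ge>1. a n \<in> {0, 1, 2}) \<and>
     (\<Inter>k\<in>{1..}. sg_cell (map a [1..<k + 1])) = {p}"

definition split_index :: "(nat \<Rightarrow> nat) \<Rightarrow> (nat \<Rightarrow> nat) \<Rightarrow> nat" where
  "split_index a b = (LEAST k. 1 \<le> k \<and> a k \<noteq> b k)"

definition alpha_coeff :: "(nat \<Rightarrow> nat) \<Rightarrow> (nat \<Rightarrow> nat) \<Rightarrow> nat \<Rightarrow> nat \<Rightarrow> real" where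
  "alpha_coeff a b k i = (if a i = b k then 0 else 1)"

definition beta_coeff :: "(nat \<Rightarrow> nat) \<Rightarrow> (nat \<Rightarrow> nat) \<Rightarrow> nat \<Rightarrow> nat \<Rightarrow> real" where
  "beta_coeff a b k i = (if b i = a k then 0 else 1)"

definition gamma_coeff :: "(nat \<Rightarrow> nat) \<Rightarrow> (nat \<Rightarrow> nat) \<Rightarrow> nat \<Rightarrow> nat \<Rightarrow> real" where
  "gamma_coeff a b k i = (if a i \<noteq> a k \<and> a i \<noteq> b k then 0 else 1)"

definition delta_coeff :: "(nat \<Rightarrow> nat) \<Rightarrow> (nat \<Rightarrow> nat) \<Rightarrow> nat \<Rightarrow> nat \<Rightarrow> real" where
  "delta_coeff a b k i = (if b i \<noteq> b k \<and> b i \<noteq> a k then 0 else 1)"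

(* The sum of c i / 2^i over all i \<ge> k + 1. *)
definition tail_series :: "nat \<Rightarrow> (nat \<Rightarrow> real) \<Rightarrow> real" where
  "tail_series k c = (\<Sum>j. c (k + 1 + j) / 2 ^ (k + 1 + j))"

definition code_dist :: "(nat \<Rightarrow> nat) \<Rightarrow> (nat \<Rightarrow> nat) \<Rightarrow> real" where
  "code_dist a b =
     (if \<forall>i\<ge>1. a i = b i then 0
      else let k = split_index a b in
        min (tail_series k (\<lambda>i. alpha_coeff a b k i + beta_coeff a b k i))
            (1 / 2 ^ k + tail_series k (\<lambda>i. gamma_coeff a b k i + delta_coeff a b k i)))"


lemma sg_map_affine:
  "sg_map i p = (1/2) *\<^sub>R p +
     (if i = 0 then (0, 0) else if i = 1 then (1/2, 0) else (1/4, sqrt 3 / 4))"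
  by (cases p) (simp add: sg_map_def)

lemma sg_map_dist: "dist (sg_map i p) (sg_map i q) = dist p q / 2"
proof -
  have "sg_map i p - sg_map i q = (1/2) *\<^sub>R (p - q)"
    by (simp add: sg_map_affine scaleR_diff_right)
  then show ?thesis by (simp add: dist_norm)
qed

lemma sg_attractor_exists: "\<exists>S. sg_attractor S"
proof -
  define F :: "(real \<times> real) set \<Rightarrow> (real \<times> real) set"
    where "F = (\<lambda>A. sg_map 0 ` A \<union> sg_map 1 ` A \<union> sg_map 2 ` A)"
  define K where "K = (\<lambda>n. (F ^^ n) ({0..1} \<times> {0..1}))"
  define S where "S = (\<Inter>n. K n)"
  have K0: "K 0 = {0..1} \<times> {0..1}" and KS: "K (Suc n) = F (K n)" for n
    by (simp_all add: K_def)
  have mono: "A \<subseteq> B \<Longrightarrow> F A \<subseteq> F B" for A B unfolding F_def by blast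
  have s3: "sqrt 3 \<le> 2" by (rule real_le_lsqrt) auto
  have "F (K 0) \<subseteq> K 0"
    using s3 unfolding K0 F_def sg_map_def by auto
  then have Kstep: "K (Suc n) \<subseteq> K n" for n
    by (induction n) (use mono KS in auto)
  then have Kanti: "m \<le> n \<Longrightarrow> K n \<subseteq> K m" for m n
    by (rule lift_Suc_antimono_le)
  have cont: "continuous_on A (sg_map i)" for A i
    unfolding sg_map_affine by (intro continuous_intros)
  have Kc: "compact (K n)" for n
  proof (induction n)
    case 0 show ?case unfolding K0 by (intro compact_Times compact_Icc)
  next
    case (Suc n) then show ?case unfolding KS F_def
      by (intro compact_Un compact_continuous_image cont)
  qed
  have Kn: "K n \<noteq> {}" for n
    by (induction n) (auto simp: K0 KS F_def)
  have Sn: "S \<noteq> {}" unfolding S_def by (rule compact_nest) (use Kc Kn Kanti in auto)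
  have Sc: "compact S" unfolding S_def by (rule compact_Inter) (use Kc in auto)
  have "F S \<subseteq> K n" for n
    using mono[of S "K n"] Kstep[of n] unfolding KS S_def by blast
  then have "F S \<subseteq> S" unfolding S_def by blast
  moreover have "S \<subseteq> F S"
  proof
    fix p assume p: "p \<in> S"
    have inj: "inj (sg_map i)" for i
      by (rule injI) (metis dist_eq_0_iff sg_map_dist divide_eq_0_iff zero_neq_numeral)
    have img: "sg_map i ` S = (\<Inter>n. sg_map i ` K n)" for i
      unfolding S_def by (rule image_INT[OF inj]) auto
    show "p \<in> F S"
    proof (rule ccontr)
      assume "p \<notin> F S"
      then obtain n0 n1 n2 where n: "p \<notin> sg_map 0 ` K n0" "p \<notin> sg_map 1 ` K n1" "p \<notin> sg_map 2 ` K n2"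
        unfolding F_def img by auto
      define N where "N = n0 + n1 + n2"
      have "K N \<subseteq> K n0" "K N \<subseteq> K n1" "K N \<subseteq> K n2"
        unfolding N_def by (auto intro!: Kanti)
      with n have "p \<notin> K (Suc N)" unfolding KS F_def by blast
      with p show False unfolding S_def by blast
    qed
  qed
  ultimately have "S = F S" by blast
  with Sn Sc show ?thesis unfolding sg_attractor_def F_def by blast
qed

lemma sg_attractor_subset:
  assumes "sg_attractor A" "sg_attractor B"
  shows "A \<subseteq> B"
proof -
  have A: "A \<noteq> {}" "compact A" "A = sg_map 0 ` A \<union> sg_map 1 ` A \<union> sg_map 2 ` A"
   and B: "B \<noteq> {}" "compact B" "B = sg_map 0 ` B \<union> sg_map 1 ` B \<union> sg_map 2 ` B"
    using assms unfolding sg_attractor_def by blast+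
  obtain u where u: "u \<in> A" "\<And>v. v \<in> A \<Longrightarrow> infdist v B \<le> infdist u B"
    using continuous_attains_sup[OF A(2,1) continuous_on_infdist[OF continuous_on_id], of B]
    by blast
  have "u \<in> sg_map 0 ` A \<union> sg_map 1 ` A \<union> sg_map 2 ` A"
    using u(1) A(3) by (rule subst[rotated])
  then obtain i v where i: "i \<in> {0,1,2}" "v \<in> A" "u = sg_map i v" by blast
  obtain w where w: "w \<in> B" "infdist v B = dist v w"
    using infdist_attains_inf[OF compact_imp_closed[OF B(2)] B(1)] by metis
  have "sg_map i w \<in> sg_map 0 ` B \<union> sg_map 1 ` B \<union> sg_map 2 ` B"
    using i(1) w(1) by blast
  then have "sg_map i w \<in> B" using B(3) by (rule ssubst[rotated])
  then have "infdist u B \<le> dist u (sg_map i w)" by (rule infdist_le)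
  also have "\<dots> = infdist v B / 2" by (simp add: i(3) sg_map_dist w(2))
  also have "\<dots> \<le> infdist u B / 2" using u(2)[OF i(2)] by simp
  finally have "infdist u B \<le> 0" by simp
  then have "infdist v B = 0" if "v \<in> A" for v
    using u(2)[OF that] infdist_nonneg[of v B] by linarith
  then show ?thesis
    using in_closed_iff_infdist_zero[OF compact_imp_closed[OF B(2)] B(1)] by blast
qed

lemma sg_attractor_unique: "\<exists>!S. sg_attractor S"
  using sg_attractor_exists sg_attractor_subset by (metis subset_antisym)

lemma sg_attractor_gasket: "sg_attractor sierpinski_gasket"
  unfolding sierpinski_gasket_def by (rule theI') (rule sg_attractor_unique)

lemma summable_tail:
  assumes "\<And>i. \<bar>c i\<bar> \<le> (2::real)"
  shows "summable (\<lambda>j. c (k + 1 + j) / 2 ^ (k + 1 + j))"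
proof (rule summable_comparison_test')
  show "summable (\<lambda>j. 2 * (1/2::real) ^ j)"
    by (intro summable_mult summable_geometric) auto
  fix j
  have "\<bar>c (k+1+j)\<bar> / 2 ^ (k+1+j) \<le> 2 / 2 ^ j"
    by (intro frac_le assms power_increasing) auto
  then show "norm (c (k + 1 + j) / 2 ^ (k + 1 + j)) \<le> 2 * (1/2) ^ j"
    by (simp add: power_divide)
qed

end

theory Submission
  imports Defs
begin

text \<open>
  The number \<open>code_dist a b\<close> is the length of a shortest path in the gasket.  If the codes differ
  for the first time at index \<open>k\<close>, the two points lie in different subtriangles of a triangle of
  side \<open>2 * (1/2)^k\<close>, and a path between them either runs through the common corner of the
  two subtriangles or crosses the third subtriangle along one side.  The tail sums are
  lengths of shortest paths from a point to a corner: the distance from the point with code \<open>a\<close> to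
  corner \<open>c\<close> is the sum of \<open>1 / 2^i\<close> over the indices \<open>i\<close> with \<open>a i \<noteq> c\<close>.

  Independence of the code rests on one observation: this corner distance is an affine
  function of the point, namely 1 minus its barycentric coordinate at the corner \<open>c\<close>
  (\<open>corner_dist_of_code\<close>).  So two codes of one point have equal corner distances.  By the
  symmetry of \<open>code_dist\<close> it is enough to replace \<open>a\<close> by another code \<open>a'\<close> of the same point
  with \<open>b\<close> fixed.  Dropping a common first digit of all three codes halves both values, which leaves
  two cases.

  If \<open>a\<close> and \<open>a'\<close> have the same first digit and \<open>b\<close> has another, the formula for \<open>code_dist\<close>
  involves \<open>a\<close> and \<open>a'\<close> only through that digit and the corner distances of their tails, and
  these agree.  If \<open>a\<close> starts with \<open>x\<close> and \<open>a'\<close> with \<open>y \<noteq> x\<close>, then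
  the barycentric coordinates at \<open>x\<close> and \<open>y\<close> are both at least 1/2, hence equal to 1/2, and this
  forces \<open>a = x y y y \<dots>\<close> and \<open>a' = y x x x \<dots>\<close>.  For these codes the two values are compared
  directly (\<open>code_dist_junction\<close>), using that the distance to a constant code is a
  corner distance (\<open>code_dist_const\<close>).
\<close>

section \<open>Corner distances\<close>

definition digits :: "(nat \<Rightarrow> nat) \<Rightarrow> bool" where
  "digits a \<longleftrightarrow> (\<forall>n\<ge>1. a n \<in> {0, 1, 2})"

definition shift :: "(nat \<Rightarrow> nat) \<Rightarrow> nat \<Rightarrow> nat" where
  "shift a = (\<lambda>n. a (Suc n))"

definition corner_dist :: "nat \<Rightarrow> (nat \<Rightarrow> nat) \<Rightarrow> real" where
  "corner_dist c a = tail_series 0 (\<lambda>i. if a i = c then 0 else 1)"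

lemma digits_shift: "digits a \<Longrightarrow> digits (shift a)"
  by (simp add: digits_def shift_def)

lemma tail_series_Suc:
  assumes "\<And>i. \<bar>c i\<bar> \<le> 2"
  shows "tail_series (Suc k) c = tail_series k (\<lambda>i. c (Suc i)) / 2"
  using suminf_divide[OF summable_tail[of "\<lambda>i. c (Suc i)" k], of 2] assms
  by (simp add: tail_series_def mult.commute)

lemma tail_series_add:
  assumes "\<And>i. \<bar>c i\<bar> \<le> 2" "\<And>i. \<bar>d i\<bar> \<le> 2"
  shows "tail_series k (\<lambda>i. c i + d i) = tail_series k c + tail_series k d"
  using suminf_add[OF summable_tail[of c k] summable_tail[of d k]] assms
  by (simp add: tail_series_def add_divide_distrib)

lemma tail_series_0_head:
  assumes "\<And>i. \<bar>c i\<bar> \<le> 2"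
  shows "tail_series 0 c = c 1 / 2 + tail_series 0 (\<lambda>i. c (Suc i)) / 2"
  using suminf_split_head[OF summable_tail[of c 0]] assms tail_series_Suc[of c 0]
  by (simp add: tail_series_def)

lemma tail_series_0_const: "tail_series 0 (\<lambda>_. c) = c"
proof -
  have "(\<lambda>j. c * (1/2) ^ Suc j) sums (c * 1)"
    by (intro sums_mult power_half_series)
  then have "(\<lambda>j. c / 2 ^ Suc j) sums c"
    by (simp add: power_divide)
  then show ?thesis by (simp add: tail_series_def sums_iff)
qed

lemma corner_dist_rec:
  "corner_dist c a = ((if a 1 = c then 0 else 1) + corner_dist c (shift a)) / 2"
  unfolding corner_dist_def
  by (subst tail_series_0_head) (auto simp: shift_def add_divide_distrib)

lemma corner_dist_nonneg: "0 \<le> corner_dist c a"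
  unfolding corner_dist_def tail_series_def by (intro suminf_nonneg summable_tail) auto

lemma corner_dist_le_1: "corner_dist c a \<le> 1"
proof -
  have "corner_dist c a \<le> tail_series 0 (\<lambda>_. 1)"
    unfolding corner_dist_def tail_series_def
    by (intro suminf_le summable_tail) (auto intro: divide_right_mono)
  then show ?thesis by (simp add: tail_series_0_const)
qed

text \<open>Every digit differs from exactly two of the three corners.\<close>

lemma corner_dist_sum:
  assumes "digits a" "{x, y, z} = {0, 1, 2}" "x \<noteq> y" "x \<noteq> z" "y \<noteq> z"
  shows "corner_dist x a + corner_dist y a + corner_dist z a = 2"
proof -
  let ?e = "\<lambda>c i. if a i = c then 0 else 1 :: real"
  have *: "?e x (Suc i) + ?e y (Suc i) + ?e z (Suc i) = 2" for i
  proof -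
    have "a (Suc i) \<in> {x, y, z}"
      using assms(1) unfolding assms(2) digits_def by simp
    then show ?thesis using assms(3-5) by auto
  qed
  have "corner_dist x a + corner_dist y a + corner_dist z a
      = tail_series 0 (\<lambda>i. ?e x i + ?e y i + ?e z i)"
    by (subst tail_series_add, simp, simp, subst tail_series_add) (auto simp: corner_dist_def)
  also have "\<dots> = tail_series 0 (\<lambda>_. 2)"
    unfolding tail_series_def using * by simp
  finally show ?thesis by (simp add: tail_series_0_const)
qed

lemma corner_dist_eq_0D:
  assumes "corner_dist c a = 0" "1 \<le> i"
  shows "a i = c"
proof -
  let ?e = "\<lambda>i. if a i = c then 0 else 1 :: real"
  have "\<forall>j. ?e (0 + 1 + j) / 2 ^ (0 + 1 + j) = 0"
    using assms(1) unfolding corner_dist_def tail_series_def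
    by (subst (asm) suminf_eq_zero_iff[OF summable_tail]) auto
  then have "?e (0 + 1 + (i - 1)) / 2 ^ (0 + 1 + (i - 1)) = 0" by blast
  then show ?thesis using assms(2) by (simp split: if_splits)
qed

lemma corner_dist_const:
  assumes "\<And>i. 1 \<le> i \<Longrightarrow> a i = y"
  shows "corner_dist c a = (if c = y then 0 else 1)"
proof -
  have "corner_dist c a = tail_series 0 (\<lambda>_. if c = y then 0 else 1)"
    unfolding corner_dist_def tail_series_def using assms by auto
  then show ?thesis by (simp add: tail_series_0_const)
qed

section \<open>Corner distances in terms of the point\<close>

text \<open>This is 1 minus the barycentric coordinate of the point at the corner \<open>c\<close> of the triangle
  with corners \<open>(0, 0)\<close>, \<open>(1, 0)\<close> and \<open>(1/2, sqrt 3 / 2)\<close>.\<close>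

definition corner_coord :: "nat \<Rightarrow> real \<times> real \<Rightarrow> real" where
  "corner_coord c p =
     (if c = 0 then fst p + snd p / sqrt 3
      else if c = 1 then 1 - fst p + snd p / sqrt 3
      else 1 - 2 * (snd p / sqrt 3))"

text \<open>The recursion satisfied by \<open>corner_dist\<close>: prefixing a code with the digit \<open>i\<close> corresponds to
  applying \<open>sg_map i\<close> to the point.\<close>

lemma corner_coord_sg_map:
  assumes "i \<in> {0, 1, 2}" "c \<in> {0, 1, 2}"
  shows "corner_coord c (sg_map i p) = ((if i = c then 0 else 1) + corner_coord c p) / 2"
  using assms by (cases p) (auto simp: corner_coord_def sg_map_def field_simps)

lemma corner_coord_cell_approx:
  assumes "digits a" "c \<in> {0, 1, 2}" "\<bar>corner_coord c x\<bar> \<le> M"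
  shows "\<bar>corner_coord c (foldr sg_map (map a [1..<k + 1]) x) - corner_dist c a\<bar> \<le> (M + 1) / 2 ^ k"
  using assms(1)
proof (induction k arbitrary: a)
  case 0
  show ?case using assms(3) corner_dist_nonneg[of c a] corner_dist_le_1[of c a] by simp
next
  case (Suc k)
  let ?y = "foldr sg_map (map (shift a) [1..<k + 1]) x"
  have "[1..<Suc k + 1] = 1 # map Suc [1..<k + 1]"
    by (simp add: map_Suc_upt upt_conv_Cons del: upt_Suc)
  then have "foldr sg_map (map a [1..<Suc k + 1]) x = sg_map (a 1) ?y"
    by (simp add: shift_def comp_def del: upt_Suc)
  moreover have "a 1 \<in> {0, 1, 2}" using Suc.prems by (simp add: digits_def)
  ultimately have "corner_coord c (foldr sg_map (map a [1..<Suc k + 1]) x) - corner_dist c a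
      = (corner_coord c ?y - corner_dist c (shift a)) / 2"
    using assms(2) by (subst corner_dist_rec) (simp only: corner_coord_sg_map, simp add: field_simps)
  then show ?case
    using Suc.IH[OF digits_shift[OF Suc.prems]] by (simp only: abs_divide) (simp add: field_simps)
qed

text \<open>The point lies in all cells of its code.  On the cell of level \<open>k\<close> the coordinate is within
  a constant times \<open>1 / 2^k\<close> of the corner distance, so that the two agree in the limit.\<close>

lemma corner_dist_of_code:
  assumes "is_code a p" "c \<in> {0, 1, 2}"
  shows "corner_dist c a = corner_coord c p"
proof -
  have dig: "digits a" using assms(1) by (simp add: is_code_def digits_def)
  have "compact sierpinski_gasket"
    using sg_attractor_gasket by (simp add: sg_attractor_def)
  moreover have "continuous_on sierpinski_gasket (corner_coord c)"
    unfolding corner_coord_def by (cases "c = 0"; cases "c = 1") (auto intro!: continuous_intros)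
  ultimately have "bounded (corner_coord c ` sierpinski_gasket)"
    by (intro compact_imp_bounded compact_continuous_image)
  then obtain M where M: "\<And>x. x \<in> sierpinski_gasket \<Longrightarrow> \<bar>corner_coord c x\<bar> \<le> M"
    by (auto simp: bounded_iff)
  have bound: "\<bar>corner_coord c p - corner_dist c a\<bar> \<le> (M + 1) * (1/2) ^ k" if "1 \<le> k" for k
  proof -
    have "p \<in> sg_cell (map a [1..<k + 1])"
      using assms(1) that unfolding is_code_def by blast
    then obtain x where "x \<in> sierpinski_gasket" "p = foldr sg_map (map a [1..<k + 1]) x"
      unfolding sg_cell_def by blast
    then show ?thesis
      using corner_coord_cell_approx[OF dig assms(2) M] by (simp add: power_divide)
  qed
  have lim: "(\<lambda>k. (M + 1) * (1/2) ^ k) \<longlonglongrightarrow> (M + 1) * 0"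
    by (intro tendsto_mult_left LIMSEQ_realpow_zero) auto
  have "\<bar>corner_coord c p - corner_dist c a\<bar> \<le> (M + 1) * 0"
    by (rule LIMSEQ_le_const[OF lim]) (use bound in blast)
  then show ?thesis by simp
qed

section \<open>Recursion for the distance of codes\<close>

lemma code_dist_refl: "\<forall>i\<ge>1. a i = b i \<Longrightarrow> code_dist a b = 0"
  by (simp add: code_dist_def)

lemma code_dist_commute: "code_dist a b = code_dist b a"
proof -
  have "split_index a b = split_index b a"
    unfolding split_index_def by metis
  moreover have "alpha_coeff a b = beta_coeff b a" "beta_coeff a b = alpha_coeff b a"
    "gamma_coeff a b = delta_coeff b a" "delta_coeff a b = gamma_coeff b a"
    by (auto simp: fun_eq_iff alpha_coeff_def beta_coeff_def gamma_coeff_def delta_coeff_def)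
  moreover have "(\<forall>i\<ge>1. a i = b i) \<longleftrightarrow> (\<forall>i\<ge>1. b i = a i)" by metis
  ultimately show ?thesis
    unfolding code_dist_def by (simp only: add.commute)
qed

lemma split_index_shift:
  assumes "a 1 = b 1" "1 \<le> j" "a j \<noteq> b j"
  shows "split_index a b = Suc (split_index (shift a) (shift b))"
proof -
  obtain i where i: "j = Suc i" "1 \<le> i"
    using assms by (cases j; cases "j = 1") auto
  let ?P = "\<lambda>k. 1 \<le> k \<and> shift a k \<noteq> shift b k"
  have least: "?P (LEAST k. ?P k)"
    by (rule LeastI[of ?P i]) (use assms i in \<open>simp add: shift_def\<close>)
  show ?thesis unfolding split_index_def
  proof (rule Least_equality)
    show "1 \<le> Suc (LEAST k. ?P k) \<and> a (Suc (LEAST k. ?P k)) \<noteq> b (Suc (LEAST k. ?P k))"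
      using least by (simp add: shift_def)
  next
    fix y assume y: "1 \<le> y \<and> a y \<noteq> b y"
    obtain l where l: "y = Suc l" "1 \<le> l"
      using y assms(1) by (cases y; cases "y = 1") auto
    then have "(LEAST k. ?P k) \<le> l"
      using y by (intro Least_le) (simp add: shift_def)
    with l show "Suc (LEAST k. ?P k) \<le> y" by simp
  qed
qed

lemma code_dist_same_head:
  assumes "a 1 = b 1"
  shows "code_dist a b = code_dist (shift a) (shift b) / 2"
proof (cases "\<forall>i\<ge>1. a i = b i")
  case True
  then show ?thesis by (simp add: code_dist_refl shift_def)
next
  case False
  then obtain j where j: "1 \<le> j" "a j \<noteq> b j" by auto
  define k where "k = split_index (shift a) (shift b)"
  have k: "split_index a b = Suc k"
    using split_index_shift[OF assms j] by (simp add: k_def)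
  obtain i where "j = Suc i" "1 \<le> i" using j assms by (cases j; cases "j = 1") auto
  then have False': "\<not> (\<forall>i\<ge>1. shift a i = shift b i)" using j by (auto simp: shift_def)
  have "tail_series (Suc k) (\<lambda>i. alpha_coeff a b (Suc k) i + beta_coeff a b (Suc k) i)
      = tail_series k (\<lambda>i. alpha_coeff (shift a) (shift b) k i + beta_coeff (shift a) (shift b) k i) / 2"
    by (subst tail_series_Suc) (auto simp: alpha_coeff_def beta_coeff_def shift_def)
  moreover
  have "tail_series (Suc k) (\<lambda>i. gamma_coeff a b (Suc k) i + delta_coeff a b (Suc k) i)
      = tail_series k (\<lambda>i. gamma_coeff (shift a) (shift b) k i + delta_coeff (shift a) (shift b) k i) / 2"
    by (subst tail_series_Suc) (auto simp: gamma_coeff_def delta_coeff_def shift_def)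
  ultimately show ?thesis
    unfolding code_dist_def if_not_P[OF False] if_not_P[OF False'] k k_def[symmetric] Let_def
    by (simp add: min_def)
qed

text \<open>A path leaves the first subtriangle either at the corner that it shares with the second one,
  or at the corner that it shares with the third one, which is then crossed along a side.\<close>

lemma code_dist_diff_head:
  assumes "digits a" "digits b" "a 1 = x" "b 1 = y" "{x, y, z} = {0, 1, 2}"
    "x \<noteq> y" "x \<noteq> z" "y \<noteq> z"
  shows "code_dist a b =
    min (corner_dist y (shift a) + corner_dist x (shift b))
        (1 + corner_dist z (shift a) + corner_dist z (shift b)) / 2"
proof -
  have k: "split_index a b = 1"
    unfolding split_index_def by (rule Least_equality) (use assms in auto)
  have third: "(u \<noteq> x \<and> u \<noteq> y) = (u = z)" if "u \<in> {0, 1, 2}" for u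
    using that assms(6-8) unfolding assms(5)[symmetric] by auto
  have "tail_series 1 (\<lambda>i. alpha_coeff a b 1 i + beta_coeff a b 1 i)
     = tail_series 0 (\<lambda>i. alpha_coeff a b 1 (Suc i) + beta_coeff a b 1 (Suc i)) / 2"
    unfolding One_nat_def by (subst tail_series_Suc) (auto simp: alpha_coeff_def beta_coeff_def)
  also have "\<dots> = (corner_dist y (shift a) + corner_dist x (shift b)) / 2"
    by (subst tail_series_add)
      (use assms in \<open>auto simp: alpha_coeff_def beta_coeff_def corner_dist_def shift_def\<close>)
  finally have 1: "tail_series 1 (\<lambda>i. alpha_coeff a b 1 i + beta_coeff a b 1 i) = \<dots>" .
  have "tail_series 1 (\<lambda>i. gamma_coeff a b 1 i + delta_coeff a b 1 i)
     = tail_series 0 (\<lambda>i. gamma_coeff a b 1 (Suc i) + delta_coeff a b 1 (Suc i)) / 2"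
    unfolding One_nat_def by (subst tail_series_Suc) (auto simp: gamma_coeff_def delta_coeff_def)
  also have "\<dots> = (tail_series 0 (\<lambda>i. gamma_coeff a b 1 (Suc i))
      + tail_series 0 (\<lambda>i. delta_coeff a b 1 (Suc i))) / 2"
    by (subst tail_series_add) (auto simp: gamma_coeff_def delta_coeff_def)
  also have "(\<lambda>i. gamma_coeff a b 1 (Suc i)) = (\<lambda>i. if shift a i = z then 0 else 1)"
    using assms(1,3,4) third by (auto simp: gamma_coeff_def shift_def digits_def fun_eq_iff)
  also have "(\<lambda>i. delta_coeff a b 1 (Suc i)) = (\<lambda>i. if shift b i = z then 0 else 1)"
    using assms(2,3,4) third by (auto simp: delta_coeff_def shift_def digits_def fun_eq_iff)
  finally have 2: "tail_series 1 (\<lambda>i. gamma_coeff a b 1 i + delta_coeff a b 1 i)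
      = (corner_dist z (shift a) + corner_dist z (shift b)) / 2"
    by (simp add: corner_dist_def)
  have "\<not> (\<forall>i\<ge>1. a i = b i)" using assms by auto
  then show ?thesis
    unfolding code_dist_def k Let_def 1 2 by (simp only: if_not_P) (simp add: min_def field_simps)
qed

lemma third_corner:
  assumes "x \<in> {0, 1, 2}" "y \<in> {0, 1, 2}" "x \<noteq> y"
  obtains z :: nat where "{x, y, z} = {0, 1, 2}" "x \<noteq> z" "y \<noteq> z"
proof -
  have "{x, y, 3 - x - y} = {0, 1, 2}" "x \<noteq> 3 - x - y" "y \<noteq> 3 - x - y"
    using assms by auto
  then show ?thesis using that by blast
qed

section \<open>Independence of the code\<close>

text \<open>A constant code represents a corner.  Removing leading digits \<open>y\<close> halves both sides; at the
  first digit of \<open>b\<close> other than \<open>y\<close>, the direct path beats the one through the third subtriangle,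
  because corner distances are at most 1.\<close>

lemma code_dist_const:
  assumes "\<And>i. 1 \<le> i \<Longrightarrow> c i = y" "y \<in> {0, 1, 2}" "digits b"
  shows "code_dist c b = corner_dist y b"
proof (cases "\<forall>i\<ge>1. b i = y")
  case True
  then show ?thesis using corner_dist_const[of b y y] assms(1) by (simp add: code_dist_refl)
next
  case False
  have diff_head: "code_dist c b = corner_dist y b"
    if c: "\<And>i. 1 \<le> i \<Longrightarrow> c i = y" and b: "digits b" "b 1 \<noteq> y" for b c
  proof -
    have dig: "b 1 \<in> {0, 1, 2}" "digits c" and c1: "c 1 = y"
      and sc: "\<And>i. 1 \<le> i \<Longrightarrow> shift c i = y"
      using b c assms(2) by (auto simp: digits_def shift_def)
    obtain z where z: "{y, b 1, z} = {0, 1, 2}" "y \<noteq> z" "b 1 \<noteq> z"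
      using third_corner[OF assms(2) dig(1)] b(2) by metis
    show ?thesis
      using code_dist_diff_head[OF dig(2) b(1) c1 refl z(1) _ z(2,3)] b(2) z(2)
        corner_dist_const[OF sc] corner_dist_rec[of y b]
        corner_dist_nonneg[of z "shift b"] corner_dist_le_1[of y "shift b"]
      by (simp add: min_def)
  qed
  from False obtain n where "b (Suc n) \<noteq> y" by (metis Suc_le_D One_nat_def)
  then show ?thesis using assms(1,3)
  proof (induction n arbitrary: b c)
    case 0
    then show ?case by (intro diff_head) auto
  next
    case (Suc n)
    show ?case
    proof (cases "b 1 = y")
      case True
      then have "code_dist c b = code_dist (shift c) (shift b) / 2"
        using Suc.prems(2) by (intro code_dist_same_head) simp
      also have "code_dist (shift c) (shift b) = corner_dist y (shift b)"
        using Suc.prems by (intro Suc.IH digits_shift) (auto simp: shift_def)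
      finally show ?thesis using True corner_dist_rec[of y b] by simp
    next
      case False
      then show ?thesis using Suc.prems by (intro diff_head) auto
    qed
  qed
qed

text \<open>The junction point with the codes \<open>x y y \<dots>\<close> and \<open>y x x \<dots>\<close>, seen from a point in the
  subtriangle \<open>x\<close>: the first code gives the distance inside that subtriangle to its corner \<open>y\<close>,
  the second the length of the direct path through this corner.\<close>

lemma code_dist_junction_same:
  assumes dig: "digits a" "digits a'" "digits b"
    and heads: "a 1 = x" "a' 1 = y" "x \<noteq> y"
    and tails: "corner_dist y (shift a) = 0" "corner_dist x (shift a') = 0"
    and b: "b 1 = x"
  shows "code_dist a b = code_dist a' b"
proof -
  have xy: "x \<in> {0, 1, 2}" "y \<in> {0, 1, 2}"
    using dig heads by (auto simp: digits_def)
  obtain z where z: "{x, y, z} = {0, 1, 2}" "x \<noteq> z" "y \<noteq> z"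
    using third_corner[OF xy heads(3)] .
  have z': "{y, x, z} = {0, 1, 2}" using z(1) by (metis insert_commute)
  have "code_dist a b = code_dist (shift a) (shift b) / 2"
    using heads b by (intro code_dist_same_head) simp
  also have "code_dist (shift a) (shift b) = corner_dist y (shift b)"
    using corner_dist_eq_0D[OF tails(1)] xy digits_shift[OF dig(3)] by (intro code_dist_const)
  also have "corner_dist y (shift b) / 2 = code_dist a' b"
  proof -
    have "corner_dist z (shift a') = 1"
      using corner_dist_const[OF corner_dist_eq_0D[OF tails(2)]] z(2) by simp
    then show ?thesis
      using code_dist_diff_head[OF dig(2,3) heads(2) b z' _ z(3,2)] heads(3) tails(2)
        corner_dist_nonneg[of z "shift b"] corner_dist_le_1[of y "shift b"]
      by (simp add: min_def)
  qed
  finally show ?thesis .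
qed

text \<open>A point in the third subtriangle \<open>z\<close> is joined to the junction point by two paths, each one
  consisting of a side of the subtriangle \<open>x\<close> or \<open>y\<close> and a path in \<open>z\<close> to a corner.  Exchanging
  the two codes only exchanges these paths.\<close>

lemma code_dist_junction:
  assumes dig: "digits a" "digits a'" "digits b"
    and heads: "a 1 = x" "a' 1 = y" "x \<noteq> y"
    and tails: "corner_dist y (shift a) = 0" "corner_dist x (shift a') = 0"
  shows "code_dist a b = code_dist a' b"
proof -
  have xy: "x \<in> {0, 1, 2}" "y \<in> {0, 1, 2}" and b1: "b 1 \<in> {0, 1, 2}"
    using dig heads by (auto simp: digits_def)
  obtain z where z: "{x, y, z} = {0, 1, 2}" "x \<noteq> z" "y \<noteq> z"
    using third_corner[OF xy heads(3)] .
  consider "b 1 = x" | "b 1 = y" | "b 1 = z"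
    using b1 unfolding z(1)[symmetric] by blast
  then show ?thesis
  proof cases
    case 1
    then show ?thesis using code_dist_junction_same[OF dig heads tails] by simp
  next
    case 2
    then show ?thesis
      using code_dist_junction_same[OF dig(2,1,3) heads(2,1) heads(3)[symmetric] tails(2,1)] by simp
  next
    case 3
    have perm: "{x, z, y} = {0, 1, 2}" "{y, z, x} = {0, 1, 2}" using z(1) by (metis insert_commute)+
    have "corner_dist z (shift a) = 1" "corner_dist z (shift a') = 1"
      using corner_dist_const[OF corner_dist_eq_0D[OF tails(1)]]
        corner_dist_const[OF corner_dist_eq_0D[OF tails(2)]] z(2,3) by auto
    then show ?thesis
      using code_dist_diff_head[OF dig(1,3) heads(1) 3 perm(1) z(2) heads(3) z(3)[symmetric]]
        code_dist_diff_head[OF dig(2,3) heads(2) 3 perm(2) z(3) heads(3)[symmetric] z(2)[symmetric]]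
        tails by (simp add: min.commute)
  qed
qed

text \<open>The first digits show that the corner distances to \<open>x\<close> and \<open>y\<close> are at most 1/2.  The three
  corner distances sum to 2 and none exceeds 1, so that these two are exactly 1/2, which forces the
  tail of \<open>a\<close> to be constantly \<open>y\<close> and that of \<open>a'\<close> to be constantly \<open>x\<close>.\<close>

lemma corner_dist_tails_junction:
  assumes dig: "digits a" "digits a'"
    and heads: "a 1 = x" "a' 1 = y" "x \<noteq> y"
    and eq: "\<And>c. c \<in> {0, 1, 2} \<Longrightarrow> corner_dist c a = corner_dist c a'"
  shows "corner_dist y (shift a) = 0" "corner_dist x (shift a') = 0"
proof -
  have xy: "x \<in> {0, 1, 2}" "y \<in> {0, 1, 2}"
    using dig heads by (auto simp: digits_def)
  obtain z where z: "{x, y, z} = {0, 1, 2}" "x \<noteq> z" "y \<noteq> z"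
    using third_corner[OF xy heads(3)] .
  note facts = corner_dist_sum[OF dig(1) z(1) heads(3) z(2,3)] corner_dist_le_1[of z a]
    corner_dist_rec[of x a] corner_dist_rec[of y a] corner_dist_rec[of x a'] corner_dist_rec[of y a']
    corner_dist_le_1[of x "shift a"] corner_dist_le_1[of y "shift a'"]
    corner_dist_nonneg[of y "shift a"] corner_dist_nonneg[of x "shift a'"]
    eq[OF xy(1)] eq[OF xy(2)]
  show "corner_dist y (shift a) = 0" "corner_dist x (shift a') = 0"
    using facts heads by (simp_all split: if_splits)
qed

text \<open>Induction on an index at which the three codes do not all agree.  The hypothesis is about corner
  distances, which pass directly to the shifted codes.\<close>

lemma code_dist_cong_left:
  assumes "digits a" "digits a'" "digits b"
    and "\<And>c. c \<in> {0, 1, 2} \<Longrightarrow> corner_dist c a = corner_dist c a'"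
  shows "code_dist a b = code_dist a' b"
proof (cases "\<forall>i\<ge>1. a i = b i \<and> a' i = b i")
  case True
  then show ?thesis by (simp add: code_dist_refl)
next
  case False
  then obtain n where "\<not> (a (Suc n) = b (Suc n) \<and> a' (Suc n) = b (Suc n))"
    by (metis Suc_le_D One_nat_def)
  then show ?thesis using assms
  proof (induction n arbitrary: a a' b rule: less_induct)
    case (less n)
    note dig = less.prems(2-4) and eq = less.prems(5)
    have eq_shift: "corner_dist c (shift a) = corner_dist c (shift a')"
      if "c \<in> {0, 1, 2}" "a 1 = a' 1" for c
      using eq[OF that(1)] that(2) corner_dist_rec[of c a] corner_dist_rec[of c a'] by simp
    show ?case
    proof (cases "a 1 = a' 1")
      case False
      note tails = corner_dist_tails_junction[OF dig(1,2) refl refl False eq]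
      show ?thesis using code_dist_junction[OF dig refl refl False tails] .
    next
      case aa': True
      show ?thesis
      proof (cases "a 1 = b 1")
        case True
        then obtain m where m: "n = Suc m"
          using less.prems(1) aa' by (cases n) auto
        have "code_dist (shift a) (shift b) = code_dist (shift a') (shift b)"
          using less.prems(1) m
          by (intro less.IH[of m] digits_shift dig eq_shift aa') (simp_all add: shift_def)
        then show ?thesis
          using True aa' by (simp add: code_dist_same_head)
      next
        case False
        have ab: "a 1 \<in> {0, 1, 2}" "b 1 \<in> {0, 1, 2}" using dig by (simp_all add: digits_def)
        obtain z where z: "{a 1, b 1, z} = {0, 1, 2}" "a 1 \<noteq> z" "b 1 \<noteq> z"
          using third_corner[OF ab False] .
        have "z \<in> {0, 1, 2}" unfolding z(1)[symmetric] by simp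
        then show ?thesis
          using code_dist_diff_head[OF dig(1,3) refl refl z(1) False z(2,3)]
            code_dist_diff_head[OF dig(2,3) aa'[symmetric] refl z(1) False z(2,3)]
            eq_shift[OF ab(2) aa'] eq_shift[of z] aa' by simp
      qed
    qed
  qed
qed

theorem proposition3p4:
  fixes p q :: "real \<times> real" and a a' b b' :: "nat \<Rightarrow> nat"
  assumes "p \<in> sierpinski_gasket" and "q \<in> sierpinski_gasket"
    and "is_code a p" and "is_code a' p"
    and "is_code b q" and "is_code b' q"
  shows "code_dist a b = code_dist a' b'"
proof -
  have dig: "digits a" "digits a'" "digits b" "digits b'"
    using assms(3-6) by (simp_all add: is_code_def digits_def)
  have "code_dist a b = code_dist a' b"
    using assms(3,4) by (intro code_dist_cong_left dig) (simp add: corner_dist_of_code)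
  also have "\<dots> = code_dist b a'" by (rule code_dist_commute)
  also have "\<dots> = code_dist b' a'"
    using assms(5,6) by (intro code_dist_cong_left dig) (simp add: corner_dist_of_code)
  also have "\<dots> = code_dist a' b'" by (rule code_dist_commute)
  finally show ?thesis .
qed

end
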